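(* Let $n\geq 2$ be an integer. Then $$\sum_{\sigma\in B_n}(-1)^{\mathrm{neg}(\sigma)}x^{\mathrm{ofmaj}(\sigma)}y^{\mathrm{odes}(\sigma)}z^{\mathrm{oneg}(\sigma)}=\frac{n!}{2^{\lfloor n/2\rfloor}}(1-xz)^{\lceil n/2\rceil}\prod_{i=1}^{\lfloor n/2\rfloor}(1-yx^{2i}),$$ and $$\sum_{\sigma\in B_n}(-1)^{\mathrm{neg}(\sigma)}x^{\mathrm{efmaj}(\sigma)}y^{\mathrm{edes}(\sigma)}z^{\mathrm{eneg}(\sigma)}=\frac{n!}{2^{\lfloor (n-1)/2\rfloor}}(1-xz)^{\lfloor n/2\rfloor}\prod_{i=0}^{\lfloor (n-1)/2\rfloor}(1-yx^{2i}).$$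
   Context: $B_n$ is the hyperoctahedral group: the group of bijections $\sigma$ of $\{-n,\dots,-1,1,\dots,n\}$ with $\sigma(-i)=-\sigma(i)$ for all $i$. For $\sigma\in B_n$ put $\sigma(0)=0$ and let $D(\sigma)=\{i\in\{0,1,\dots,n-1\}:\sigma(i)>\sigma(i+1)\}$, $\mathrm{Neg}(\sigma)=\{i\in\{1,\dots,n\}:\sigma(i)<0\}$, $\mathrm{neg}(\sigma)=|\mathrm{Neg}(\sigma)|$. For a set $J$ of integers, $J_o$ and $J_e$ denote its subsets of odd, respectively even, elements ($0$ is even). Define $\mathrm{odes}(\sigma)=|D(\sigma)_o|$, $\mathrm{edes}(\sigma)=|D(\sigma)_e|$, $\mathrm{omaj}(\sigma)=\sum_{i\in D(\sigma)_o}\frac{i+1}{2}$, $\mathrm{emaj}(\sigma)=\sum_{i\in D(\sigma)_e}\frac{i}{2}$, $\mathrm{oneg}(\sigma)=|\mathrm{Neg}(\sigma)_o|$, $\mathrm{eneg}(\sigma)=|\mathrm{Neg}(\sigma)_e|$, $\mathrm{ofmaj}(\sigma)=2\,\mathrm{omaj}(\sigma)+\mathrm{oneg}(\sigma)$, $\mathrm{efmaj}(\sigma)=2\,\mathrm{emaj}(\sigma)+\mathrm{eneg}(\sigma)$. *)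

theory Defs
  imports Complex_Main "HOL-Combinatorics.Permutations"
begin

text \<open>
  A signed permutation is represented by a function on all integers that is the identity outside
  \<open>{-n, \<dots>, -1, 1, \<dots>, n}\<close>, so that distinct elements of the group are distinct functions. In
  particular \<open>\<sigma> 0 = 0\<close>, which is the convention used for the descent at position 0.
\<close>

definition hyperoctahedral :: "nat \<Rightarrow> (int \<Rightarrow> int) set" where
  "hyperoctahedral n =
     {\<sigma>. \<sigma> permutes ({- int n..int n} - {0}) \<and>
         (\<forall>i \<in> {- int n..int n} - {0}. \<sigma> (- i) = - \<sigma> i)}"

lemma finite_hyperoctahedral: "finite (hyperoctahedral n)"
  unfolding hyperoctahedral_def
  by (rule finite_subset[OF _ finite_permutations[of "{- int n..int n} - {0}"]]) auto

definition Des :: "nat \<Rightarrow> (int \<Rightarrow> int) \<Rightarrow> nat set" where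
  "Des n \<sigma> = {i \<in> {0..<n}. \<sigma> (int i) > \<sigma> (int i + 1)}"

definition Neg :: "nat \<Rightarrow> (int \<Rightarrow> int) \<Rightarrow> nat set" where
  "Neg n \<sigma> = {i \<in> {1..n}. \<sigma> (int i) < 0}"

definition odd_part :: "nat set \<Rightarrow> nat set" where
  "odd_part J = {i \<in> J. odd i}"

definition even_part :: "nat set \<Rightarrow> nat set" where
  "even_part J = {i \<in> J. even i}"

definition neg :: "nat \<Rightarrow> (int \<Rightarrow> int) \<Rightarrow> nat" where
  "neg n \<sigma> = card (Neg n \<sigma>)"

definition odes :: "nat \<Rightarrow> (int \<Rightarrow> int) \<Rightarrow> nat" where
  "odes n \<sigma> = card (odd_part (Des n \<sigma>))"

definition edes :: "nat \<Rightarrow> (int \<Rightarrow> int) \<Rightarrow> nat" where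
  "edes n \<sigma> = card (even_part (Des n \<sigma>))"

text \<open>The divisions by 2 below are exact, by the parity of the summation index.\<close>

definition omaj :: "nat \<Rightarrow> (int \<Rightarrow> int) \<Rightarrow> nat" where
  "omaj n \<sigma> = (\<Sum>i\<in>odd_part (Des n \<sigma>). (i + 1) div 2)"

definition emaj :: "nat \<Rightarrow> (int \<Rightarrow> int) \<Rightarrow> nat" where
  "emaj n \<sigma> = (\<Sum>i\<in>even_part (Des n \<sigma>). i div 2)"

definition oneg :: "nat \<Rightarrow> (int \<Rightarrow> int) \<Rightarrow> nat" where
  "oneg n \<sigma> = card (odd_part (Neg n \<sigma>))"

definition eneg :: "nat \<Rightarrow> (int \<Rightarrow> int) \<Rightarrow> nat" where
  "eneg n \<sigma> = card (even_part (Neg n \<sigma>))"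

definition ofmaj :: "nat \<Rightarrow> (int \<Rightarrow> int) \<Rightarrow> nat" where
  "ofmaj n \<sigma> = 2 * omaj n \<sigma> + oneg n \<sigma>"

definition efmaj :: "nat \<Rightarrow> (int \<Rightarrow> int) \<Rightarrow> nat" where
  "efmaj n \<sigma> = 2 * emaj n \<sigma> + eneg n \<sigma>"

end

theory Submission
  imports Defs
begin

text \<open>
  Both weights are products of local factors. In the odd case cut the positions \<open>1, \<dots>, n\<close> into
  the pairs \<open>(1,2), (3,4), \<dots>\<close> and, if \<open>n\<close> is odd, the single position \<open>n\<close>; in the even case cut
  them into the single position \<open>1\<close>, the pairs \<open>(2,3), (4,5), \<dots>\<close> and, if \<open>n\<close> is even, the single
  position \<open>n\<close>. The descents that are counted lie exactly between the two members of a pair (the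
  descent at \<open>0\<close> says that \<open>\<sigma> 1 < 0\<close>, so it belongs to the single position \<open>1\<close>), and the
  negative positions that are marked with \<open>x * z\<close> are never right members of a pair.

  A pair of entries \<open>(u, v)\<close> contributes \<open>-1\<close> for each negative entry, a further \<open>t\<close> if \<open>u < 0\<close>,
  and \<open>q\<close> if \<open>u > v\<close>. Summed over the four choices of signs this gives \<open>(1 - t) * (1 - q)\<close> when
  \<open>\<bar>u\<bar> < \<bar>v\<bar>\<close>. When \<open>\<bar>u\<bar> > \<bar>v\<bar>\<close> the sign of \<open>v\<close> affects nothing but the factor \<open>-1\<close>, and the
  sum vanishes (\<open>pair_weight_sum_signs\<close>). So adding the two orders of the entries as well, the
  total over the eight rearrangements of a pair is \<open>(1 - t) * (1 - q)\<close>, whatever the entries are.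
  A single position has total \<open>1 - t\<close> over its two signs.

  These rearrangements are right multiplications by elements of the hyperoctahedral group, which
  permute the group and leave the factors of all other blocks unchanged. Hence each factor may be
  replaced by its average, which is the constant \<open>(1 - t) * (1 - q) / 8\<close> or \<open>(1 - t) / 2\<close>
  (\<open>sum_pair_block\<close>, \<open>sum_single_block\<close>). As the group has \<open>2 ^ n * fact n\<close> elements, \<open>m\<close> pairs
  and \<open>n - 2 * m\<close> singles leave the constant \<open>fact n / 2 ^ m\<close>
  (\<open>sum_hyperoctahedral_paired\<close>).
\<close>

section \<open>Signed transpositions and the order of the hyperoctahedral group\<close>

text \<open>
  For nonzero \<open>a \<noteq> b\<close> these are the reflections of the hyperoctahedral group. The case \<open>b = - a\<close>
  is the change of sign at \<open>a\<close>, so that one definition yields all the moves inside a block.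
\<close>

definition signed_swap :: "int \<Rightarrow> int \<Rightarrow> int \<Rightarrow> int" where
  "signed_swap a b i =
     (if i = a then b else if i = b then a else if i = - a then - b else if i = - b then - a else i)"

abbreviation signed_range :: "nat \<Rightarrow> int set" where
  "signed_range n \<equiv> {- int n..int n} - {0}"

lemma signed_swap_involution:
  assumes "a \<noteq> 0" "b \<noteq> 0"
  shows "signed_swap a b (signed_swap a b i) = i"
  using assms by (auto simp: signed_swap_def)

lemma signed_swap_odd:
  assumes "a \<noteq> 0" "b \<noteq> 0"
  shows "signed_swap a b (- i) = - signed_swap a b i"
  using assms by (auto simp: signed_swap_def)

lemma permutes_if_involution:
  assumes "\<And>i. f (f i) = i" "\<And>i. i \<notin> S \<Longrightarrow> f i = i"
  shows "f permutes S"
  unfolding permutes_def using assms by metis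

lemma signed_swap_in_hyperoctahedral:
  assumes "a \<in> signed_range n" "b \<in> signed_range n"
  shows "signed_swap a b \<in> hyperoctahedral n"
proof -
  have "signed_swap a b permutes signed_range n"
    using assms by (intro permutes_if_involution signed_swap_involution)
      (auto simp: signed_swap_def)
  then show ?thesis
    using assms by (auto simp: hyperoctahedral_def signed_swap_odd)
qed

lemma hyperoctahedral_odd:
  assumes "\<sigma> \<in> hyperoctahedral n"
  shows "\<sigma> (- i) = - \<sigma> i"
proof (cases "i \<in> signed_range n")
  case True
  then show ?thesis using assms by (auto simp: hyperoctahedral_def)
next
  case False
  then have "- i \<notin> signed_range n" by auto
  then show ?thesis
    using False assms permutes_not_in unfolding hyperoctahedral_def
    by (metis (no_types, lifting) mem_Collect_eq)
qed

lemma hyperoctahedral_inj: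
  assumes "\<sigma> \<in> hyperoctahedral n"
  shows "\<sigma> i = \<sigma> j \<longleftrightarrow> i = j"
  using assms permutes_inj by (auto simp: hyperoctahedral_def dest: injD)

lemma hyperoctahedral_eq_uminus:
  assumes "\<sigma> \<in> hyperoctahedral n"
  shows "\<sigma> i = - \<sigma> j \<longleftrightarrow> i = - j"
  by (metis assms hyperoctahedral_inj hyperoctahedral_odd)

lemma hyperoctahedral_eq_0:
  assumes "\<sigma> \<in> hyperoctahedral n"
  shows "\<sigma> i = 0 \<longleftrightarrow> i = 0"
  using hyperoctahedral_eq_uminus[OF assms, of i i] by auto

lemma hyperoctahedral_compose:
  assumes "\<sigma> \<in> hyperoctahedral n" "\<tau> \<in> hyperoctahedral n"
  shows "\<sigma> \<circ> \<tau> \<in> hyperoctahedral n"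
proof -
  have "\<sigma> \<circ> \<tau> permutes signed_range n"
    using assms by (auto simp: hyperoctahedral_def intro: permutes_compose)
  then show ?thesis
    unfolding hyperoctahedral_def
    by (simp add: hyperoctahedral_odd[OF assms(1)] hyperoctahedral_odd[OF assms(2)])
qed

lemma hyperoctahedral_mono:
  assumes "m \<le> n"
  shows "hyperoctahedral m \<subseteq> hyperoctahedral n"
proof
  fix \<sigma> assume \<sigma>: "\<sigma> \<in> hyperoctahedral m"
  have "signed_range m \<subseteq> signed_range n" using assms by auto
  then have "\<sigma> permutes signed_range n"
    using \<sigma> permutes_subset by (auto simp: hyperoctahedral_def)
  then show "\<sigma> \<in> hyperoctahedral n"
    using hyperoctahedral_odd[OF \<sigma>] by (simp add: hyperoctahedral_def)
qed

lemma hyperoctahedral_fixing_last: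
  assumes "\<sigma> \<in> hyperoctahedral (Suc n)" "\<sigma> (int (Suc n)) = int (Suc n)"
  shows "\<sigma> \<in> hyperoctahedral n"
proof -
  have "\<sigma> (- int (Suc n)) = - int (Suc n)"
    by (simp only: hyperoctahedral_odd[OF assms(1)] assms(2))
  then have "\<sigma> i = i" if "i \<in> signed_range (Suc n) - signed_range n" for i
  proof -
    have "i = int (Suc n) \<or> i = - int (Suc n)"
      using that by auto
    then show ?thesis
      using assms(2) \<open>\<sigma> (- int (Suc n)) = - int (Suc n)\<close> by (elim disjE) (simp_all only:)
  qed
  moreover have "\<sigma> permutes signed_range (Suc n)"
    using assms(1) by (simp only: hyperoctahedral_def mem_Collect_eq)
  ultimately have "\<sigma> permutes signed_range n"
    using permutes_superset[of \<sigma> "signed_range (Suc n)" "signed_range n"] by blast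
  then show ?thesis
    using hyperoctahedral_odd[OF assms(1)] by (simp add: hyperoctahedral_def)
qed

text \<open>
  Composing with the reflection that exchanges \<open>\<sigma> (n + 1)\<close> and \<open>n + 1\<close> makes the last position
  a fixed point. Thus an element is determined by its last value, one of \<open>2 * (n + 1)\<close>, and an
  element of the smaller group.
\<close>

lemma card_hyperoctahedral_Suc:
  "card (hyperoctahedral (Suc n)) = 2 * Suc n * card (hyperoctahedral n)"
proof -
  let ?N = "int (Suc n)"
  have range: "?N \<in> signed_range (Suc n)" by simp
  have fix_last: "\<tau> ?N = ?N" if "\<tau> \<in> hyperoctahedral n" for \<tau>
    using that permutes_not_in[of \<tau> "signed_range n" ?N] by (simp add: hyperoctahedral_def)
  have swap_last: "signed_swap ?N v ?N = v" "signed_swap ?N v v = ?N" for v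
    by (auto simp: signed_swap_def)
  have "bij_betw (\<lambda>(v, \<tau>). signed_swap ?N v \<circ> \<tau>)
          (signed_range (Suc n) \<times> hyperoctahedral n) (hyperoctahedral (Suc n))"
  proof (rule bij_betwI[where g = "\<lambda>\<sigma>. (\<sigma> ?N, signed_swap ?N (\<sigma> ?N) \<circ> \<sigma>)"])
    show "(\<lambda>(v, \<tau>). signed_swap ?N v \<circ> \<tau>)
        \<in> signed_range (Suc n) \<times> hyperoctahedral n \<rightarrow> hyperoctahedral (Suc n)"
    proof
      fix p assume "p \<in> signed_range (Suc n) \<times> hyperoctahedral n"
      then obtain v \<tau> where p: "p = (v, \<tau>)"
        and v: "v \<in> signed_range (Suc n)" and \<tau>: "\<tau> \<in> hyperoctahedral n"
        by blast
      have "signed_swap ?N v \<circ> \<tau> \<in> hyperoctahedral (Suc n)"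
        using v \<tau> range hyperoctahedral_mono[of n "Suc n"]
        by (intro hyperoctahedral_compose signed_swap_in_hyperoctahedral) auto
      then show "(case p of (v, \<tau>) \<Rightarrow> signed_swap ?N v \<circ> \<tau>) \<in> hyperoctahedral (Suc n)"
        by (simp add: p)
    qed
  next
    show "(\<lambda>\<sigma>. (\<sigma> ?N, signed_swap ?N (\<sigma> ?N) \<circ> \<sigma>))
        \<in> hyperoctahedral (Suc n) \<rightarrow> signed_range (Suc n) \<times> hyperoctahedral n"
    proof
      fix \<sigma> assume \<sigma>: "\<sigma> \<in> hyperoctahedral (Suc n)"
      then have v: "\<sigma> ?N \<in> signed_range (Suc n)"
        using range permutes_in_image[of \<sigma> "signed_range (Suc n)" ?N]
        unfolding hyperoctahedral_def by blast
      have "signed_swap ?N (\<sigma> ?N) \<circ> \<sigma> \<in> hyperoctahedral (Suc n)"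
        by (intro hyperoctahedral_compose signed_swap_in_hyperoctahedral range v \<sigma>)
      then have "signed_swap ?N (\<sigma> ?N) \<circ> \<sigma> \<in> hyperoctahedral n"
        by (rule hyperoctahedral_fixing_last) (simp only: comp_apply swap_last)
      then show "(\<sigma> ?N, signed_swap ?N (\<sigma> ?N) \<circ> \<sigma>) \<in> signed_range (Suc n) \<times> hyperoctahedral n"
        using v by blast
    qed
  next
    fix p assume "p \<in> signed_range (Suc n) \<times> hyperoctahedral n"
    then obtain v \<tau> where p: "p = (v, \<tau>)"
      and v: "v \<noteq> 0" and \<tau>: "\<tau> \<in> hyperoctahedral n"
      by blast
    show "(\<lambda>\<sigma>. (\<sigma> ?N, signed_swap ?N (\<sigma> ?N) \<circ> \<sigma>)) ((\<lambda>(v, \<tau>). signed_swap ?N v \<circ> \<tau>) p) = p"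
      using v by (simp add: p fix_last[OF \<tau>] swap_last fun_eq_iff signed_swap_involution
          del: of_nat_Suc)
  next
    fix \<sigma> assume "\<sigma> \<in> hyperoctahedral (Suc n)"
    then have "\<sigma> ?N \<noteq> 0" by (simp add: hyperoctahedral_eq_0)
    then show "(\<lambda>(v, \<tau>). signed_swap ?N v \<circ> \<tau>) (\<sigma> ?N, signed_swap ?N (\<sigma> ?N) \<circ> \<sigma>) = \<sigma>"
      by (simp add: fun_eq_iff signed_swap_involution del: of_nat_Suc)
  qed
  then have "card (hyperoctahedral (Suc n)) = card (signed_range (Suc n)) * card (hyperoctahedral n)"
    by (metis bij_betw_same_card card_cartesian_product)
  moreover have "card (signed_range (Suc n)) = 2 * Suc n"
    by (subst card_Diff_singleton) auto
  ultimately show ?thesis by (simp only:)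
qed

lemma card_hyperoctahedral: "card (hyperoctahedral n) = 2 ^ n * fact n"
proof (induction n)
  case 0
  have "hyperoctahedral 0 = {id}"
    by (auto simp: hyperoctahedral_def)
  then show ?case by simp
next
  case (Suc n)
  have "card (hyperoctahedral (Suc n)) = 2 * Suc n * (2 ^ n * fact n)"
    unfolding card_hyperoctahedral_Suc Suc.IH ..
  also have "\<dots> = 2 ^ Suc n * fact (Suc n)"
    by (simp only: power_Suc fact_Suc of_nat_id mult_ac)
  finally show ?case .
qed

section \<open>Averaging over the moves of a block\<close>

lemma sum_hyperoctahedral_average:
  fixes P f :: "(int \<Rightarrow> int) \<Rightarrow> 'a :: comm_ring_1"
  assumes "a \<in> signed_range n" "b \<in> signed_range n"
    and inv: "\<And>\<sigma>. \<sigma> \<in> hyperoctahedral n \<Longrightarrow> P (\<sigma> \<circ> signed_swap a b) = P \<sigma>"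
  shows "2 * (\<Sum>\<sigma>\<in>hyperoctahedral n. P \<sigma> * f \<sigma>) =
         (\<Sum>\<sigma>\<in>hyperoctahedral n. P \<sigma> * (f \<sigma> + f (\<sigma> \<circ> signed_swap a b)))"
proof -
  let ?s = "signed_swap a b"
  have "?s \<circ> ?s = id"
    using assms(1,2) by (auto simp: fun_eq_iff signed_swap_involution)
  then have "(\<Sum>\<sigma>\<in>hyperoctahedral n. P \<sigma> * f \<sigma>) =
      (\<Sum>\<sigma>\<in>hyperoctahedral n. P (\<sigma> \<circ> ?s) * f (\<sigma> \<circ> ?s))"
    using assms(1,2) signed_swap_in_hyperoctahedral hyperoctahedral_compose
    by (intro sum.reindex_bij_witness[of _ "\<lambda>\<sigma>. \<sigma> \<circ> ?s" "\<lambda>\<sigma>. \<sigma> \<circ> ?s"])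
      (auto simp: comp_assoc)
  also have "\<dots> = (\<Sum>\<sigma>\<in>hyperoctahedral n. P \<sigma> * f (\<sigma> \<circ> ?s))"
    by (intro sum.cong) (auto simp: inv)
  finally show ?thesis
    by (simp add: distrib_left sum.distrib)
qed

text \<open>
  Locality of a statistic: its value on the group is determined by the entries at the positions
  in \<open>K\<close>. Positions are positive, since an odd function is known from its positive half.
\<close>

definition depends_only :: "nat \<Rightarrow> nat set \<Rightarrow> ((int \<Rightarrow> int) \<Rightarrow> 'a) \<Rightarrow> bool" where
  "depends_only n K P \<longleftrightarrow> (\<forall>\<sigma>\<in>hyperoctahedral n. \<forall>\<tau>\<in>hyperoctahedral n.
     (\<forall>k\<in>K. \<sigma> (int k) = \<tau> (int k)) \<longrightarrow> P \<sigma> = P \<tau>)"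

lemma depends_only_swap:
  assumes "depends_only n K P" "\<sigma> \<in> hyperoctahedral n"
    and "a \<in> signed_range n" "b \<in> signed_range n"
    and "nat \<bar>a\<bar> \<notin> K" "nat \<bar>b\<bar> \<notin> K"
  shows "P (\<sigma> \<circ> signed_swap a b) = P \<sigma>"
proof -
  have "int k \<notin> {a, b, - a, - b}" if "k \<in> K" for k
  proof -
    have "k \<noteq> nat \<bar>a\<bar>" "k \<noteq> nat \<bar>b\<bar>" using that assms(5,6) by auto
    then show ?thesis by auto
  qed
  then have "\<forall>k\<in>K. (\<sigma> \<circ> signed_swap a b) (int k) = \<sigma> (int k)"
    by (auto simp: signed_swap_def)
  then show ?thesis
    using assms signed_swap_in_hyperoctahedral hyperoctahedral_compose
    unfolding depends_only_def by metis
qed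

definition sign_weight :: "'a \<Rightarrow> int \<Rightarrow> 'a :: comm_ring_1" where
  "sign_weight t u = (if u < 0 then - t else 1)"

definition pair_weight :: "'a \<Rightarrow> 'a \<Rightarrow> int \<Rightarrow> int \<Rightarrow> 'a :: comm_ring_1" where
  "pair_weight t q u v = sign_weight t u * sign_weight 1 v * (if v < u then q else 1)"

text \<open>
  If \<open>\<bar>v\<bar> < \<bar>u\<bar>\<close>, the order of the entries is decided by the sign of \<open>u\<close> alone, so that the two
  signs of \<open>v\<close> cancel. If \<open>\<bar>u\<bar> < \<bar>v\<bar>\<close>, it is decided by the sign of \<open>v\<close> alone, and the sum splits
  into a factor for each entry.
\<close>

lemma pair_weight_sum_signs:
  assumes "u \<noteq> 0" "v \<noteq> 0" "u \<noteq> v" "u \<noteq> - v"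
  shows "pair_weight t q u v + pair_weight t q (- u) v
       + (pair_weight t q u (- v) + pair_weight t q (- u) (- v))
       = (if \<bar>u\<bar> < \<bar>v\<bar> then (1 - t) * (1 - q) else 0)"
proof -
  consider "0 < u" "0 < v" | "0 < u" "v < 0" | "u < 0" "0 < v" | "u < 0" "v < 0"
    using assms by linarith
  then show ?thesis
    using assms by cases (auto simp: pair_weight_def sign_weight_def algebra_simps)
qed

lemma sum_single_block:
  fixes P :: "(int \<Rightarrow> int) \<Rightarrow> 'a :: field_char_0"
  assumes "depends_only n K P" "i \<in> {1..n}" "i \<notin> K"
  shows "(\<Sum>\<sigma>\<in>hyperoctahedral n. P \<sigma> * sign_weight t (\<sigma> (int i)))
       = (1 - t) / 2 * (\<Sum>\<sigma>\<in>hyperoctahedral n. P \<sigma>)"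
proof -
  let ?s = "signed_swap (int i) (- int i)"
  have range: "int i \<in> signed_range n" "- int i \<in> signed_range n"
    using assms(2) by auto
  have "2 * (\<Sum>\<sigma>\<in>hyperoctahedral n. P \<sigma> * sign_weight t (\<sigma> (int i)))
      = (\<Sum>\<sigma>\<in>hyperoctahedral n.
           P \<sigma> * (sign_weight t (\<sigma> (int i)) + sign_weight t ((\<sigma> \<circ> ?s) (int i))))"
    using assms range by (intro sum_hyperoctahedral_average depends_only_swap) auto
  also have "\<dots> = (\<Sum>\<sigma>\<in>hyperoctahedral n. P \<sigma> * (1 - t))"
  proof (rule sum.cong)
    fix \<sigma> assume \<sigma>: "\<sigma> \<in> hyperoctahedral n"
    have "\<sigma> (int i) \<noteq> 0" using hyperoctahedral_eq_0[OF \<sigma>] assms(2) by auto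
    then show "P \<sigma> * (sign_weight t (\<sigma> (int i)) + sign_weight t ((\<sigma> \<circ> ?s) (int i))) = P \<sigma> * (1 - t)"
      using assms(2) by (auto simp: sign_weight_def signed_swap_def hyperoctahedral_odd[OF \<sigma>])
  qed simp
  also have "\<dots> = (1 - t) * (\<Sum>\<sigma>\<in>hyperoctahedral n. P \<sigma>)"
    by (simp only: sum_distrib_right[symmetric] mult.commute)
  finally show ?thesis by (simp add: field_simps)
qed

text \<open>
  The weight of the pair is averaged in turn over the sign at \<open>i\<close>, the sign at \<open>j\<close> and the
  exchange of both positions. After the exchange exactly one of the two orders has increasing
  absolute values, so the total is the same for every element of the group.
\<close>

lemma sum_pair_block:
  fixes P :: "(int \<Rightarrow> int) \<Rightarrow> 'a :: field_char_0"
  assumes "depends_only n K P" "i \<in> {1..n}" "j \<in> {1..n}" "i \<noteq> j" "i \<notin> K" "j \<notin> K"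
  shows "(\<Sum>\<sigma>\<in>hyperoctahedral n. P \<sigma> * pair_weight t q (\<sigma> (int i)) (\<sigma> (int j)))
       = (1 - t) * (1 - q) / 8 * (\<Sum>\<sigma>\<in>hyperoctahedral n. P \<sigma>)"
proof -
  let ?B = "hyperoctahedral n" and ?i = "int i" and ?j = "int j"
  let ?w = "pair_weight t q"
  let ?w1 = "\<lambda>u v. ?w u v + ?w (- u) v"
  let ?w2 = "\<lambda>u v. ?w1 u v + ?w1 u (- v)"
  let ?w3 = "\<lambda>u v. ?w2 u v + ?w2 v u"
  note [simp] = signed_swap_def
  have range: "?i \<in> signed_range n" "- ?i \<in> signed_range n"
    "?j \<in> signed_range n" "- ?j \<in> signed_range n"
    using assms(2,3) by auto
  have average: "2 * (\<Sum>\<sigma>\<in>?B. P \<sigma> * f (\<sigma> ?i) (\<sigma> ?j)) =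
      (\<Sum>\<sigma>\<in>?B. P \<sigma> * (f (\<sigma> ?i) (\<sigma> ?j)
        + f (\<sigma> (signed_swap a b ?i)) (\<sigma> (signed_swap a b ?j))))"
    if "a \<in> {?i, ?j}" "b \<in> {?j, - ?i, - ?j}" for f a b
  proof -
    have ab: "a \<in> signed_range n" "b \<in> signed_range n" "nat \<bar>a\<bar> \<notin> K" "nat \<bar>b\<bar> \<notin> K"
      using that range assms(5,6) by auto
    show ?thesis
      using sum_hyperoctahedral_average[OF ab(1,2), of P "\<lambda>\<sigma>. f (\<sigma> ?i) (\<sigma> ?j)"]
        depends_only_swap[OF assms(1) _ ab] by simp
  qed
  have "8 * (\<Sum>\<sigma>\<in>?B. P \<sigma> * ?w (\<sigma> ?i) (\<sigma> ?j)) = 4 * (2 * (\<Sum>\<sigma>\<in>?B. P \<sigma> * ?w (\<sigma> ?i) (\<sigma> ?j)))"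
    by simp
  also have "2 * (\<Sum>\<sigma>\<in>?B. P \<sigma> * ?w (\<sigma> ?i) (\<sigma> ?j)) = (\<Sum>\<sigma>\<in>?B. P \<sigma> * ?w1 (\<sigma> ?i) (\<sigma> ?j))"
    using assms(2-4) by (subst average[of ?i "- ?i"])
      (auto intro!: sum.cong simp: hyperoctahedral_odd)
  also have "4 * \<dots> = 2 * (2 * \<dots>)"
    by simp
  also have "2 * (\<Sum>\<sigma>\<in>?B. P \<sigma> * ?w1 (\<sigma> ?i) (\<sigma> ?j)) = (\<Sum>\<sigma>\<in>?B. P \<sigma> * ?w2 (\<sigma> ?i) (\<sigma> ?j))"
    using assms(2-4) by (subst average[of ?j "- ?j" ?w1])
      (auto intro!: sum.cong simp: hyperoctahedral_odd)
  also have "2 * \<dots> = (\<Sum>\<sigma>\<in>?B. P \<sigma> * ?w3 (\<sigma> ?i) (\<sigma> ?j))"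
    using assms(2-4) by (subst average[of ?i ?j ?w2]) (auto intro!: sum.cong)
  also have "\<dots> = (\<Sum>\<sigma>\<in>?B. P \<sigma> * ((1 - t) * (1 - q)))"
  proof (rule sum.cong)
    fix \<sigma> assume \<sigma>: "\<sigma> \<in> ?B"
    let ?u = "\<sigma> ?i" and ?v = "\<sigma> ?j"
    have uv: "?u \<noteq> 0" "?v \<noteq> 0" "?u \<noteq> ?v" "?u \<noteq> - ?v"
      using assms(2-4) by (auto simp: hyperoctahedral_eq_0[OF \<sigma>] hyperoctahedral_inj[OF \<sigma>]
          hyperoctahedral_eq_uminus[OF \<sigma>])
    then have "?w3 ?u ?v = (1 - t) * (1 - q)"
      by (subst (1 2) pair_weight_sum_signs) auto
    then show "P \<sigma> * ?w3 ?u ?v = P \<sigma> * ((1 - t) * (1 - q))" by simp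
  qed simp
  also have "\<dots> = (1 - t) * (1 - q) * (\<Sum>\<sigma>\<in>?B. P \<sigma>)"
    by (simp only: sum_distrib_right[symmetric] mult.commute)
  finally show ?thesis by (simp add: field_simps)
qed

text \<open>
  In the next two inductions the factor of the new block is absorbed into \<open>P\<close>, at the price of
  enlarging \<open>K\<close> by its positions; it is averaged out last, once the other blocks are constants.
\<close>

lemma sum_single_blocks:
  fixes P :: "(int \<Rightarrow> int) \<Rightarrow> 'a :: field_char_0"
  assumes "finite S" "S \<subseteq> {1..n}" "S \<inter> K = {}" "depends_only n K P"
  shows "(\<Sum>\<sigma>\<in>hyperoctahedral n. P \<sigma> * (\<Prod>i\<in>S. sign_weight (t i) (\<sigma> (int i))))
       = (\<Prod>i\<in>S. (1 - t i) / 2) * (\<Sum>\<sigma>\<in>hyperoctahedral n. P \<sigma>)"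
  using assms
proof (induction S arbitrary: P K)
  case empty
  then show ?case by simp
next
  case (insert a S)
  let ?P = "\<lambda>\<sigma>. P \<sigma> * sign_weight (t a) (\<sigma> (int a))"
  have dep: "depends_only n (insert a K) ?P"
    using insert.prems(3) unfolding depends_only_def by (metis insertCI)
  have "(\<Sum>\<sigma>\<in>hyperoctahedral n. P \<sigma> * (\<Prod>i\<in>insert a S. sign_weight (t i) (\<sigma> (int i))))
      = (\<Sum>\<sigma>\<in>hyperoctahedral n. ?P \<sigma> * (\<Prod>i\<in>S. sign_weight (t i) (\<sigma> (int i))))"
    using insert.hyps by (simp add: mult.assoc)
  also have "\<dots> = (\<Prod>i\<in>S. (1 - t i) / 2) * (\<Sum>\<sigma>\<in>hyperoctahedral n. ?P \<sigma>)"
    using insert.prems insert.hyps by (intro insert.IH[OF _ _ dep]) auto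
  also have "(\<Sum>\<sigma>\<in>hyperoctahedral n. ?P \<sigma>) = (1 - t a) / 2 * (\<Sum>\<sigma>\<in>hyperoctahedral n. P \<sigma>)"
    using insert.prems by (intro sum_single_block) auto
  finally show ?case using insert.hyps by simp
qed

lemma sum_pair_blocks:
  fixes P :: "(int \<Rightarrow> int) \<Rightarrow> 'a :: field_char_0"
  assumes "finite M" "M \<subseteq> {1..<n}" "M \<inter> Suc ` M = {}"
    and "(M \<union> Suc ` M) \<inter> K = {}" "depends_only n K P"
  shows "(\<Sum>\<sigma>\<in>hyperoctahedral n.
            P \<sigma> * (\<Prod>i\<in>M. pair_weight (t i) (q i) (\<sigma> (int i)) (\<sigma> (int (Suc i)))))
       = (\<Prod>i\<in>M. (1 - t i) * (1 - q i) / 8) * (\<Sum>\<sigma>\<in>hyperoctahedral n. P \<sigma>)"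
  using assms
proof (induction M arbitrary: P K)
  case empty
  then show ?case by simp
next
  case (insert a M)
  let ?w = "\<lambda>\<sigma> i. pair_weight (t i) (q i) (\<sigma> (int i)) (\<sigma> (int (Suc i)))"
  let ?P = "\<lambda>\<sigma>. P \<sigma> * ?w \<sigma> a"
  have dep: "depends_only n (insert a (insert (Suc a) K)) ?P"
    using insert.prems(4) unfolding depends_only_def by (metis insertCI)
  have "(\<Sum>\<sigma>\<in>hyperoctahedral n. P \<sigma> * (\<Prod>i\<in>insert a M. ?w \<sigma> i))
      = (\<Sum>\<sigma>\<in>hyperoctahedral n. ?P \<sigma> * (\<Prod>i\<in>M. ?w \<sigma> i))"
    using insert.hyps by (simp add: mult.assoc)
  also have "\<dots> = (\<Prod>i\<in>M. (1 - t i) * (1 - q i) / 8) * (\<Sum>\<sigma>\<in>hyperoctahedral n. ?P \<sigma>)"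
    using insert.prems insert.hyps by (intro insert.IH[OF _ _ _ dep]) auto
  also have "(\<Sum>\<sigma>\<in>hyperoctahedral n. ?P \<sigma>)
      = (1 - t a) * (1 - q a) / 8 * (\<Sum>\<sigma>\<in>hyperoctahedral n. P \<sigma>)"
    using insert.prems by (intro sum_pair_block) auto
  finally show ?case using insert.hyps by simp
qed

text \<open>
  The common form of both identities: \<open>M\<close> consists of the left members of the pairs, and right
  members carry the weight \<open>u = 1\<close>, a bare sign.
\<close>

lemma sum_hyperoctahedral_paired:
  fixes u q :: "nat \<Rightarrow> 'a :: field_char_0"
  assumes M: "M \<subseteq> {1..<n}" "M \<inter> Suc ` M = {}" and u: "\<And>i. i \<in> M \<Longrightarrow> u (Suc i) = 1"
  shows "(\<Sum>\<sigma>\<in>hyperoctahedral n. (\<Prod>i\<in>{1..n}. sign_weight (u i) (\<sigma> (int i))) *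
            (\<Prod>i\<in>M. if \<sigma> (int i) > \<sigma> (int i + 1) then q i else 1))
       = fact n / 2 ^ card M * (\<Prod>i\<in>{1..n} - Suc ` M. 1 - u i) * (\<Prod>i\<in>M. 1 - q i)"
proof -
  let ?B = "hyperoctahedral n"
  define S where "S = {1..n} - (M \<union> Suc ` M)"
  have fin: "finite M" "finite S"
    using M(1) finite_subset S_def by auto
  have split: "(\<Prod>i\<in>{1..n}. g i) = (\<Prod>i\<in>S. g i) * (\<Prod>i\<in>M. g i * g (Suc i))" for g :: "nat \<Rightarrow> 'a"
  proof -
    have "{1..n} = S \<union> (M \<union> Suc ` M)"
      using M(1) by (auto simp: S_def)
    then have "(\<Prod>i\<in>{1..n}. g i) = (\<Prod>i\<in>S \<union> (M \<union> Suc ` M). g i)"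
      by (rule arg_cong)
    also have "\<dots> = (\<Prod>i\<in>S. g i) * (\<Prod>i\<in>M \<union> Suc ` M. g i)"
      using fin by (intro prod.union_disjoint) (auto simp: S_def)
    also have "(\<Prod>i\<in>M \<union> Suc ` M. g i) = (\<Prod>i\<in>M. g i) * (\<Prod>i\<in>M. g (Suc i))"
      using fin M(2) by (simp add: prod.union_disjoint prod.reindex)
    finally show ?thesis by (simp add: prod.distrib)
  qed
  have "(\<Sum>\<sigma>\<in>?B. (\<Prod>i\<in>{1..n}. sign_weight (u i) (\<sigma> (int i))) *
          (\<Prod>i\<in>M. if \<sigma> (int i) > \<sigma> (int i + 1) then q i else 1))
      = (\<Sum>\<sigma>\<in>?B. (\<Prod>i\<in>S. sign_weight (u i) (\<sigma> (int i))) *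
          (\<Prod>i\<in>M. pair_weight (u i) (q i) (\<sigma> (int i)) (\<sigma> (int (Suc i)))))"
    unfolding split
    by (intro sum.cong)
      (simp_all add: mult.assoc prod.distrib[symmetric] pair_weight_def u add.commute
        cong: prod.cong)
  also have "\<dots> = (\<Prod>i\<in>M. (1 - u i) * (1 - q i) / 8) *
      (\<Sum>\<sigma>\<in>?B. \<Prod>i\<in>S. sign_weight (u i) (\<sigma> (int i)))"
    by (rule sum_pair_blocks[OF fin(1) M, of S])
      (auto simp: S_def depends_only_def intro!: prod.cong)
  also have "(\<Sum>\<sigma>\<in>?B. \<Prod>i\<in>S. sign_weight (u i) (\<sigma> (int i)))
      = (\<Prod>i\<in>S. (1 - u i) / 2) * of_nat (card ?B)"
    using sum_single_blocks[of S n "{}" "\<lambda>_. 1" u] fin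
    by (simp add: depends_only_def S_def)
  also have "(\<Prod>i\<in>M. (1 - u i) * (1 - q i) / 8) * \<dots>
      = (fact n * 2 ^ n) / (8 ^ card M * 2 ^ card S) *
        ((\<Prod>i\<in>S. 1 - u i) * (\<Prod>i\<in>M. 1 - u i)) * (\<Prod>i\<in>M. 1 - q i)"
    by (simp add: card_hyperoctahedral prod_dividef prod.distrib)
  also have "(\<Prod>i\<in>S. 1 - u i) * (\<Prod>i\<in>M. 1 - u i) = (\<Prod>i\<in>{1..n} - Suc ` M. 1 - u i)"
  proof -
    have "{1..n} - Suc ` M = S \<union> M" "S \<inter> M = {}"
      using M by (auto simp: S_def)
    then show ?thesis using fin by (simp add: prod.union_disjoint)
  qed
  also have "(fact n * 2 ^ n) / (8 ^ card M * 2 ^ card S) = (fact n / 2 ^ card M :: 'a)"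
  proof -
    have "card (M \<union> Suc ` M) = 2 * card M"
      using fin M(2) by (simp add: card_Un_disjoint card_image)
    moreover have "M \<union> Suc ` M \<subseteq> {1..n}" using M(1) by auto
    ultimately have "card S = n - 2 * card M" "2 * card M \<le> n"
      using fin card_mono[of "{1..n}" "M \<union> Suc ` M"]
      by (auto simp: S_def card_Diff_subset)
    then have n: "n = 2 * card M + card S" by simp
    have "(2 :: 'a) ^ n = 2 ^ (2 * card M + card S)"
      by (rule arg_cong[OF n])
    also have "\<dots> = 4 ^ card M * 2 ^ card S"
      by (simp add: power_add power_mult)
    finally have "(2 :: 'a) ^ n = 4 ^ card M * 2 ^ card S" .
    moreover have "(8 :: 'a) ^ card M = 4 ^ card M * 2 ^ card M"
      by (simp add: power_mult_distrib[symmetric])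
    ultimately show ?thesis by simp
  qed
  finally show ?thesis .
qed

section \<open>The two weights as products over positions\<close>

lemma power_card_filter:
  fixes c :: "'a :: comm_monoid_mult"
  assumes "finite A"
  shows "c ^ card {i \<in> A. Q i} = (\<Prod>i\<in>A. if Q i then c else 1)"
  using prod.inter_filter[OF assms, of "\<lambda>_. c" Q] by simp

lemma odd_weight_factor:
  fixes x y z :: "'a :: comm_ring_1"
  shows "(-1) ^ neg n \<sigma> * x ^ ofmaj n \<sigma> * y ^ odes n \<sigma> * z ^ oneg n \<sigma>
    = (\<Prod>i\<in>{1..n}. sign_weight (if odd i then x * z else 1) (\<sigma> (int i))) *
      (\<Prod>i\<in>{i\<in>{1..<n}. odd i}. if \<sigma> (int i) > \<sigma> (int i + 1) then y * x ^ (i + 1) else 1)"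
proof -
  let ?D = "odd_part (Des n \<sigma>)"
  have D: "?D = {i \<in> {i\<in>{1..<n}. odd i}. \<sigma> (int i) > \<sigma> (int i + 1)}"
    by (auto simp: odd_part_def Des_def Suc_le_eq odd_pos)
  have "2 * omaj n \<sigma> = (\<Sum>i\<in>?D. i + 1)"
    unfolding omaj_def sum_distrib_left by (intro sum.cong) (auto simp: odd_part_def)
  then have "x ^ (2 * omaj n \<sigma>) * y ^ odes n \<sigma> = (\<Prod>i\<in>?D. y * x ^ (i + 1))"
    by (simp only: power_sum odes_def prod.distrib prod_constant mult.commute)
  also have "\<dots> = (\<Prod>i\<in>{i\<in>{1..<n}. odd i}. if \<sigma> (int i) > \<sigma> (int i + 1) then y * x ^ (i + 1) else 1)"
    unfolding D by (rule prod.inter_filter) simp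
  finally have des: "x ^ (2 * omaj n \<sigma>) * y ^ odes n \<sigma> = \<dots>" .
  have "odd_part (Neg n \<sigma>) = {i\<in>{1..n}. \<sigma> (int i) < 0 \<and> odd i}"
    by (auto simp: odd_part_def Neg_def)
  then have "(-1) ^ neg n \<sigma> * (x * z) ^ oneg n \<sigma>
      = (\<Prod>i\<in>{1..n}. if \<sigma> (int i) < 0 then -1 else 1) *
        (\<Prod>i\<in>{1..n}. if \<sigma> (int i) < 0 \<and> odd i then x * z else 1)"
    by (simp only: neg_def Neg_def oneg_def power_card_filter finite_atLeastAtMost)
  also have "\<dots> = (\<Prod>i\<in>{1..n}. sign_weight (if odd i then x * z else 1) (\<sigma> (int i)))"
    unfolding prod.distrib[symmetric] by (intro prod.cong) (auto simp: sign_weight_def)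
  finally have signs: "(-1) ^ neg n \<sigma> * (x * z) ^ oneg n \<sigma> = \<dots>" .
  have "(-1) ^ neg n \<sigma> * x ^ ofmaj n \<sigma> * y ^ odes n \<sigma> * z ^ oneg n \<sigma>
      = ((-1) ^ neg n \<sigma> * (x * z) ^ oneg n \<sigma>) * (x ^ (2 * omaj n \<sigma>) * y ^ odes n \<sigma>)"
    by (simp add: ofmaj_def power_add power_mult_distrib mult_ac)
  then show ?thesis
    unfolding des signs .
qed

text \<open>
  The even descent at \<open>0\<close> contributes \<open>y\<close> exactly when \<open>\<sigma> 1 < 0\<close>; this is why \<open>y\<close> appears as the
  weight of the sign at position \<open>1\<close>.
\<close>

lemma even_weight_factor:
  fixes x y z :: "'a :: comm_ring_1"
  assumes "\<sigma> \<in> hyperoctahedral n" "n \<ge> 1"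
  shows "(-1) ^ neg n \<sigma> * x ^ efmaj n \<sigma> * y ^ edes n \<sigma> * z ^ eneg n \<sigma>
    = (\<Prod>i\<in>{1..n}. sign_weight (if i = 1 then y else if even i then x * z else 1) (\<sigma> (int i))) *
      (\<Prod>i\<in>{i\<in>{1..<n}. even i}. if \<sigma> (int i) > \<sigma> (int i + 1) then y * x ^ i else 1)"
proof -
  let ?D = "even_part (Des n \<sigma>)"
  have D: "?D = {i \<in> insert 0 {i\<in>{1..<n}. even i}. \<sigma> (int i) > \<sigma> (int i + 1)}"
    using assms(2) by (auto simp: even_part_def Des_def Suc_le_eq)
  have "\<sigma> 0 = 0" using hyperoctahedral_eq_0[OF assms(1)] by simp
  have "2 * emaj n \<sigma> = (\<Sum>i\<in>?D. i)"
    unfolding emaj_def sum_distrib_left by (intro sum.cong) (auto simp: even_part_def)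
  then have "x ^ (2 * emaj n \<sigma>) * y ^ edes n \<sigma> = (\<Prod>i\<in>?D. y * x ^ i)"
    by (simp only: power_sum edes_def prod.distrib prod_constant mult.commute)
  also have "\<dots> = (\<Prod>i\<in>insert 0 {i\<in>{1..<n}. even i}.
      if \<sigma> (int i) > \<sigma> (int i + 1) then y * x ^ i else 1)"
    unfolding D by (rule prod.inter_filter) simp
  also have "\<dots> = (if \<sigma> 1 < 0 then y else 1) * (\<Prod>i\<in>{i\<in>{1..<n}. even i}.
      if \<sigma> (int i) > \<sigma> (int i + 1) then y * x ^ i else 1)"
    using \<open>\<sigma> 0 = 0\<close> by simp
  finally have des: "x ^ (2 * emaj n \<sigma>) * y ^ edes n \<sigma> = \<dots>" .
  have "even_part (Neg n \<sigma>) = {i\<in>{1..n}. \<sigma> (int i) < 0 \<and> even i}"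
    by (auto simp: even_part_def Neg_def)
  then have neg: "(-1) ^ neg n \<sigma> * (x * z) ^ eneg n \<sigma>
      = (\<Prod>i\<in>{1..n}. if \<sigma> (int i) < 0 then -1 else 1) *
        (\<Prod>i\<in>{1..n}. if \<sigma> (int i) < 0 \<and> even i then x * z else 1)"
    by (simp only: neg_def Neg_def eneg_def power_card_filter finite_atLeastAtMost)
  have descent0: "(if \<sigma> 1 < 0 then y else 1)
      = (\<Prod>i\<in>{1..n}. if i = 1 then if \<sigma> (int i) < 0 then y else 1 else 1)"
    using assms(2) by (simp add: prod.delta)
  have signs: "(if \<sigma> 1 < 0 then y else 1) * ((-1) ^ neg n \<sigma> * (x * z) ^ eneg n \<sigma>)
      = (\<Prod>i\<in>{1..n}. sign_weight (if i = 1 then y else if even i then x * z else 1) (\<sigma> (int i)))"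
    unfolding neg descent0 prod.distrib[symmetric]
    by (intro prod.cong) (auto simp: sign_weight_def)
  have "(-1) ^ neg n \<sigma> * x ^ efmaj n \<sigma> * y ^ edes n \<sigma> * z ^ eneg n \<sigma>
      = ((-1) ^ neg n \<sigma> * (x * z) ^ eneg n \<sigma>) * (x ^ (2 * emaj n \<sigma>) * y ^ edes n \<sigma>)"
    by (simp add: efmaj_def power_add power_mult_distrib mult_ac)
  then show ?thesis
    unfolding des signs[symmetric] by (simp only: mult_ac)
qed

section \<open>The signed generating functions\<close>

lemma odd_lefts_eq:
  fixes n :: nat
  shows "{i\<in>{1..<n}. odd i} = (\<lambda>j. 2 * j - 1) ` {1..n div 2}"
proof (intro set_eqI iffI)
  fix i assume "i \<in> {i\<in>{1..<n}. odd i}"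
  then show "i \<in> (\<lambda>j. 2 * j - 1) ` {1..n div 2}"
    by (intro image_eqI[of _ _ "(i + 1) div 2"]) (auto elim!: oddE)
qed auto

lemma even_lefts_eq:
  fixes n :: nat
  shows "{i\<in>{1..<n}. even i} = (*) 2 ` {1..(n - 1) div 2}"
proof (intro set_eqI iffI)
  fix i assume "i \<in> {i\<in>{1..<n}. even i}"
  then show "i \<in> (*) 2 ` {1..(n - 1) div 2}"
    by (intro image_eqI[of _ _ "i div 2"]) auto
qed auto

lemma evens_eq:
  fixes n :: nat
  shows "{i\<in>{1..n}. even i} = (*) 2 ` {1..n div 2}"
proof (intro set_eqI iffI)
  fix i assume "i \<in> {i\<in>{1..n}. even i}"
  then show "i \<in> (*) 2 ` {1..n div 2}"
    by (intro image_eqI[of _ _ "i div 2"]) auto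
qed auto

lemma odds_eq:
  fixes n :: nat
  shows "{i\<in>{1..n}. odd i} = (\<lambda>j. 2 * j - 1) ` {1..(n + 1) div 2}"
proof (intro set_eqI iffI)
  fix i assume "i \<in> {i\<in>{1..n}. odd i}"
  then show "i \<in> (\<lambda>j. 2 * j - 1) ` {1..(n + 1) div 2}"
    by (intro image_eqI[of _ _ "(i + 1) div 2"]) (auto elim!: oddE)
qed auto

theorem theorem4p14:
  fixes n :: nat and x y z :: "'a :: field_char_0"
  assumes "n \<ge> 2"
  shows "((\<Sum>\<sigma>\<in>hyperoctahedral n.
            (-1) ^ neg n \<sigma> * x ^ ofmaj n \<sigma> * y ^ odes n \<sigma> * z ^ oneg n \<sigma>) =
         fact n / 2 ^ (n div 2) * (1 - x * z) ^ nat \<lceil>real n / 2\<rceil> *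
           (\<Prod>i=1..n div 2. 1 - y * x ^ (2 * i))) \<and>
         ((\<Sum>\<sigma>\<in>hyperoctahedral n.
            (-1) ^ neg n \<sigma> * x ^ efmaj n \<sigma> * y ^ edes n \<sigma> * z ^ eneg n \<sigma>) =
         fact n / 2 ^ ((n - 1) div 2) * (1 - x * z) ^ (n div 2) *
           (\<Prod>i=0..(n - 1) div 2. 1 - y * x ^ (2 * i)))"
proof
  let ?M = "{i\<in>{1..<n}. odd i}"
  let ?u = "\<lambda>i. if odd i then x * z else 1"
  have inj: "inj_on (\<lambda>j :: nat. 2 * j - 1) {1..k}" for k
    by (auto simp: inj_on_def)
  have rest: "{1..n} - Suc ` ?M = {i\<in>{1..n}. odd i}"
  proof -
    have "i \<in> Suc ` ?M" if "i \<in> {1..n}" "even i" for i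
      using that by (intro image_eqI[of _ _ "i - 1"]) auto
    then show ?thesis by auto
  qed
  have card_odds: "card {i\<in>{1..n}. odd i} = (n + 1) div 2"
    by (simp only: odds_eq card_image[OF inj] card_atLeastAtMost)
  have "nat \<lceil>real n / 2\<rceil> = (n + 1) div 2"
    by linarith
  then have "nat \<lceil>real n / 2\<rceil> = card {i\<in>{1..n}. odd i}"
    using card_odds by (simp only:)
  then have singles: "(\<Prod>i\<in>{1..n} - Suc ` ?M. 1 - ?u i) = (1 - x * z) ^ nat \<lceil>real n / 2\<rceil>"
    unfolding rest by (simp only: prod_constant[symmetric]) (intro prod.cong, auto)
  have pairs: "(\<Prod>i\<in>?M. 1 - y * x ^ (i + 1)) = (\<Prod>i=1..n div 2. 1 - y * x ^ (2 * i))"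
  proof -
    have exponent: "2 * j - 1 + 1 = 2 * j" if "j \<in> {1..n div 2}" for j :: nat
      using that by simp
    show ?thesis
      unfolding odd_lefts_eq prod.reindex[OF inj]
      by (intro prod.cong refl) (simp only: comp_apply exponent)
  qed
  have card: "card ?M = n div 2"
    by (simp only: odd_lefts_eq card_image[OF inj]) simp
  show "(\<Sum>\<sigma>\<in>hyperoctahedral n.
            (-1) ^ neg n \<sigma> * x ^ ofmaj n \<sigma> * y ^ odes n \<sigma> * z ^ oneg n \<sigma>) =
         fact n / 2 ^ (n div 2) * (1 - x * z) ^ nat \<lceil>real n / 2\<rceil> *
           (\<Prod>i=1..n div 2. 1 - y * x ^ (2 * i))"
    unfolding odd_weight_factor
    by (subst sum_hyperoctahedral_paired) (auto simp only: singles pairs card, auto)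
next
  let ?M = "{i\<in>{1..<n}. even i}"
  let ?u = "\<lambda>i. if i = 1 then y else if even i then x * z else 1"
  have inj: "inj_on ((*) 2) {1..k}" for k :: nat
    by (auto simp: inj_on_def)
  have rest: "{1..n} - Suc ` ?M = insert 1 {i\<in>{1..n}. even i}"
  proof -
    have "i \<in> Suc ` ?M" if "i \<in> {1..n}" "odd i" "i \<noteq> 1" for i
      using that by (intro image_eqI[of _ _ "i - 1"]) (auto elim: oddE)
    then have "{i\<in>{1..n}. odd i \<and> i \<noteq> 1} \<subseteq> Suc ` ?M"
      by blast
    moreover have "Suc ` ?M \<subseteq> {i\<in>{1..n}. odd i \<and> i \<noteq> 1}"
      by auto
    ultimately have rights: "Suc ` ?M = {i\<in>{1..n}. odd i \<and> i \<noteq> 1}"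
      by (rule equalityI[rotated])
    show ?thesis unfolding rights using assms by auto
  qed
  have "(\<Prod>i\<in>{i\<in>{1..n}. even i}. 1 - ?u i) = (\<Prod>i\<in>{i\<in>{1..n}. even i}. 1 - x * z)"
    by (intro prod.cong) auto
  then have "(\<Prod>i\<in>{1..n} - Suc ` ?M. 1 - ?u i) = (1 - y) * (\<Prod>i\<in>{i\<in>{1..n}. even i}. 1 - x * z)"
    unfolding rest by (subst prod.insert) (simp_all del: prod_constant)
  then have singles: "(\<Prod>i\<in>{1..n} - Suc ` ?M. 1 - ?u i) = (1 - y) * (1 - x * z) ^ (n div 2)"
    by (simp only: prod_constant evens_eq card_image[OF inj]) simp
  have pairs: "(\<Prod>i\<in>?M. 1 - y * x ^ i) = (\<Prod>i=1..(n - 1) div 2. 1 - y * x ^ (2 * i))"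
    unfolding even_lefts_eq by (subst prod.reindex[OF inj]) simp
  have card: "card ?M = (n - 1) div 2"
    by (simp only: even_lefts_eq card_image[OF inj]) simp
  have "(\<Sum>\<sigma>\<in>hyperoctahedral n.
          (-1) ^ neg n \<sigma> * x ^ efmaj n \<sigma> * y ^ edes n \<sigma> * z ^ eneg n \<sigma>)
      = (\<Sum>\<sigma>\<in>hyperoctahedral n. (\<Prod>i\<in>{1..n}. sign_weight (?u i) (\<sigma> (int i))) *
          (\<Prod>i\<in>?M. if \<sigma> (int i) > \<sigma> (int i + 1) then y * x ^ i else 1))"
    using assms by (intro sum.cong even_weight_factor) auto
  also have "\<dots> = fact n / 2 ^ ((n - 1) div 2) * ((1 - y) * (1 - x * z) ^ (n div 2)) *
      (\<Prod>i=1..(n - 1) div 2. 1 - y * x ^ (2 * i))"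
    by (subst sum_hyperoctahedral_paired) (auto simp only: singles pairs card, auto)
  also have "\<dots> = fact n / 2 ^ ((n - 1) div 2) * (1 - x * z) ^ (n div 2) *
      (\<Prod>i=0..(n - 1) div 2. 1 - y * x ^ (2 * i))"
    by (subst prod.atLeast_Suc_atMost[of 0]) (simp_all add: mult_ac)
  finally show "(\<Sum>\<sigma>\<in>hyperoctahedral n.
            (-1) ^ neg n \<sigma> * x ^ efmaj n \<sigma> * y ^ edes n \<sigma> * z ^ eneg n \<sigma>) =
         fact n / 2 ^ ((n - 1) div 2) * (1 - x * z) ^ (n div 2) *
           (\<Prod>i=0..(n - 1) div 2. 1 - y * x ^ (2 * i))" .
qed

end
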